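(* Let $s\ge1$ be an integer, $m=2^s$, let $r>4$, let $H$ be a Hadamard matrix of order $r$, let $u$ satisfy $(u^2+u^{-2})^2=r$, and let $a$ be a primitive $2m^2$-th root of unity. Then the spin model $W_{H,u,a}$ (of index $m$) cannot be written as a tensor product $W_1\otimes W_2\otimes\cdots\otimes W_v$ with $v\ge 2$, where each $W_k$ has size greater than $1$ and belongs to one of the families (a)–(e) of known spin models described below (equality understood after identifying the index set of $W_{H,u,a}$ with the product of the index sets of the $W_k$ by a bijection).
   Context: Notation: for a positive integer $r'$, $Y'=\{1,\dots,r'\}$; for even $m'$, $X'=\{(i,\ell,x)\mid i,\ell\in\mathbb{Z}_{m'},x\in Y'\}$ with $\mathbb{Z}_{m'}$ identified with $\{0,\dots,m'-1\}$. A Hadamard matrix of order $r'$ is an $r'\times r'$ matrix $H'$ with entries $\pm1$ and $H'H'^T=r'I$. For $u'$ with $(u'^2+u'^{-2})^2=r'$ if $r'\ge2$ and $u'^4=1$ if $r'=1$, the Potts model is $A_{u'}=u'^3I-u'^{-1}(J-I)$ ($J$ the all-ones matrix). Put $V_{ij}=A_{u'}$ if $i-j$ even, $V_{ij}=H'$ if $(i,j)\equiv(0,1)\pmod 2$, $V_{ij}=H'^T$ if $(i,j)\equiv(1,0)\pmod2$. For a primitive $2m'^2$-th root of unity $a'$, $W_{H',u',a'}$ is the matrix on $X'$ with $W_{H',u',a'}((i,\ell,x),(j,\ell',y))=a'^{2m'(\ell-\ell')(i-j)+(i-j)^2+m'(i-j)}V_{ij}(x,y)$. For a primitive $m'$-th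 root of unity $\eta$ and an $m'^2$-th root of unity $b'$, $W'_{H',u',b'}$ is the matrix on $X'$ with entries $\eta^{(\ell-\ell')(i-j)}b'^{(i-j)^2}V_{ij}(x,y)$. These are spin models (in the sense: nonzero entries, $\sum_x W(\alpha,x)/W(\beta,x)=n\delta_{\alpha\beta}$, and $\sum_x W(\alpha,x)W(\beta,x)/W(\gamma,x)=D\,W(\alpha,\beta)/(W(\alpha,\gamma)W(\gamma,\beta))$ for a real $D$ with $D^2=n$ the size). The families of known spin models are: (a) Potts models $A_{u'}$ of size $r'\ge2$. (b) Spin models on finite abelian groups: $U$ a finite abelian group, $U=U_1\oplus\cdots\oplus U_h$ a decomposition into cyclic groups, $a_i$ a generator of $U_i$ of order $n_i$, $\{\chi_c\mid c\in U\}$ the characters of $U$ indexed so that $\chi_c(d)=\chi_d(c)$; for $x=\sum x_ia_i$ ($0\le x_i<n_i$) put $t_x=t_0\prod_i\eta_i^{x_i}\chi_{a_i}(a_i)^{x_i(x_i-1)/2}\prod_{\ell<k}\chi_{a_\ell}(a_k)^{x_\ell x_k}$, where $\eta_i^{n_i}=\chi_{a_i}(a_i)^{-n_i(n_i-1)/2}$ and $t_0^2=D^{-1}\sum_{x\in U}\prod_j\eta_j^{-x_j}\chi_{a_j}(a_j)^{-x_j(x_j-1)/2}\prod_{\ell<k}\chi_{a_\ell}(a_k)^{-x_\ell x_k}$ with $D^2=|U|$; the spin model is $W_U(\alpha,\beta)=t_{\beta-\alpha}$ for $\alpha,\beta\in U$. (c) Jaeger's Higman–Sims model $W_J=-\tau^5I-\tau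 A+\tau^{-1}(J-A-I)$ of size $100$, where $A$ is the adjacency matrix of the Higman–Sims graph and $\tau^2+\tau^{-2}=3$. (d) The matrices $W_{H',u',a'}$ above (any even $m'$, any $r'$ admitting a Hadamard matrix). (e) The matrices $W'_{H',u',b'}$ above. *)

theory Defs
  imports Complex_Main "HOL-Algebra.Multiplicative_Group" "HOL-Algebra.Product_Groups"
begin

text \<open>
  A complex matrix with rows and columns indexed by a finite set \<open>I :: 'i set\<close> is a function
  \<open>'i \<Rightarrow> 'i \<Rightarrow> complex\<close>, of which only the values on \<open>I\<close> matter; its size is \<open>card I\<close>.
  Matrices are compared up to a bijection of index sets.
\<close>

definition same_matrix ::
    "'i set \<Rightarrow> ('i \<Rightarrow> 'i \<Rightarrow> complex) \<Rightarrow> 'j set \<Rightarrow> ('j \<Rightarrow> 'j \<Rightarrow> complex) \<Rightarrow> bool" where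
  "same_matrix I M J N \<longleftrightarrow>
     (\<exists>f. bij_betw f I J \<and> (\<forall>x\<in>I. \<forall>y\<in>I. M x y = N (f x) (f y)))"

definition tensor_index :: "nat \<Rightarrow> (nat \<Rightarrow> 'i set) \<Rightarrow> (nat \<Rightarrow> 'i) set" where
  "tensor_index v I = (\<Pi>\<^sub>E k\<in>{1..v}. I k)"

definition tensor ::
    "nat \<Rightarrow> (nat \<Rightarrow> 'i \<Rightarrow> 'i \<Rightarrow> complex) \<Rightarrow> (nat \<Rightarrow> 'i) \<Rightarrow> (nat \<Rightarrow> 'i) \<Rightarrow> complex" where
  "tensor v W \<alpha> \<beta> = (\<Prod>k\<in>{1..v}. W k (\<alpha> k) (\<beta> k))"

definition primitive_root_of_unity :: "nat \<Rightarrow> complex \<Rightarrow> bool" where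
  "primitive_root_of_unity n z \<longleftrightarrow>
     n > 0 \<and> z ^ n = 1 \<and> (\<forall>k. 0 < k \<and> k < n \<longrightarrow> z ^ k \<noteq> 1)"

definition hadamard :: "nat \<Rightarrow> (nat \<Rightarrow> nat \<Rightarrow> complex) \<Rightarrow> bool" where
  "hadamard r H \<longleftrightarrow>
     (\<forall>x\<in>{1..r}. \<forall>y\<in>{1..r}. H x y = 1 \<or> H x y = -1) \<and>
     (\<forall>x\<in>{1..r}. \<forall>y\<in>{1..r}. (\<Sum>z\<in>{1..r}. H x z * H y z) = (if x = y then of_nat r else 0))"


subsection \<open>Potts models\<close>

definition potts_param :: "nat \<Rightarrow> complex \<Rightarrow> bool" where
  "potts_param r u \<longleftrightarrow>
     (if r = 1 then u ^ 4 = 1 else (u ^ 2 + inverse u ^ 2) ^ 2 = of_nat r)"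

definition potts_matrix :: "complex \<Rightarrow> 'i \<Rightarrow> 'i \<Rightarrow> complex" where
  "potts_matrix u x y = (if x = y then u ^ 3 else - inverse u)"

definition potts_model :: "'i set \<Rightarrow> ('i \<Rightarrow> 'i \<Rightarrow> complex) \<Rightarrow> bool" where
  "potts_model I W \<longleftrightarrow>
     card I \<ge> 2 \<and>
     (\<exists>u. potts_param (card I) u \<and> (\<forall>x\<in>I. \<forall>y\<in>I. W x y = potts_matrix u x y))"


subsection \<open>Spin models on finite abelian groups\<close>

text \<open>Groups are written multiplicatively, as in HOL-Algebra.\<close>

definition complex_mult_group :: "complex monoid" where
  "complex_mult_group = \<lparr>carrier = UNIV - {0}, monoid.mult = (*), one = 1\<rparr>"

definition characters :: "('g, 'b) monoid_scheme \<Rightarrow> ('g \<Rightarrow> complex) set" where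
  "characters G = hom G complex_mult_group \<inter> extensional (carrier G)"

definition symmetric_character_indexing ::
    "('g, 'b) monoid_scheme \<Rightarrow> ('g \<Rightarrow> 'g \<Rightarrow> complex) \<Rightarrow> bool" where
  "symmetric_character_indexing G \<chi> \<longleftrightarrow>
     bij_betw (\<lambda>c. restrict (\<chi> c) (carrier G)) (carrier G) (characters G) \<and>
     (\<forall>c\<in>carrier G. \<forall>d\<in>carrier G. \<chi> c d = \<chi> d c)"

text \<open>\<open>G\<close> is the internal direct product of the cyclic subgroups generated by \<open>a 1, \<dots>, a h\<close>.\<close>

definition cyclic_decomposition ::
    "('g, 'b) monoid_scheme \<Rightarrow> nat \<Rightarrow> (nat \<Rightarrow> 'g) \<Rightarrow> bool" where
  "cyclic_decomposition G h a \<longleftrightarrow>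
     a \<in> {1..h} \<rightarrow> carrier G \<and>
     (\<lambda>x. finprod G x {1..h}) \<in> iso (product_group {1..h} (\<lambda>i. subgroup_generated G {a i})) G"

text \<open>The quotient \<open>t\<^sub>x / t\<^sub>0\<close>, for the group element with exponent vector \<open>x\<close>.\<close>

definition theta ::
    "nat \<Rightarrow> ('g \<Rightarrow> 'g \<Rightarrow> complex) \<Rightarrow> (nat \<Rightarrow> 'g) \<Rightarrow> (nat \<Rightarrow> complex) \<Rightarrow> (nat \<Rightarrow> nat) \<Rightarrow> complex" where
  "theta h \<chi> a \<eta> x =
     (\<Prod>i\<in>{1..h}. \<eta> i ^ x i * \<chi> (a i) (a i) ^ (x i * (x i - 1) div 2)) *
     (\<Prod>k\<in>{1..h}. \<Prod>l\<in>{1..<k}. \<chi> (a l) (a k) ^ (x l * x k))"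

definition group_model :: "'i set \<Rightarrow> ('i \<Rightarrow> 'i \<Rightarrow> complex) \<Rightarrow> bool" where
  "group_model I W \<longleftrightarrow>
     (\<exists>(G :: 'i monoid) h a n E \<chi> \<eta> (D :: real) t0 t.
        comm_group G \<and> finite (carrier G) \<and> carrier G = I \<and>
        cyclic_decomposition G h a \<and>
        (\<forall>i\<in>{1..h}. n i = group.ord G (a i)) \<and>
        E = (\<Pi>\<^sub>E i\<in>{1..h}. {0..<n i}) \<and>
        symmetric_character_indexing G \<chi> \<and>
        (\<forall>i\<in>{1..h}. \<eta> i ^ n i = inverse (\<chi> (a i) (a i) ^ (n i * (n i - 1) div 2))) \<and>
        D ^ 2 = real (card I) \<and>
        t0 ^ 2 = inverse (of_real D) * (\<Sum>x\<in>E. inverse (theta h \<chi> a \<eta> x)) \<and>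
        (\<forall>x\<in>E. t (finprod G (\<lambda>i. a i [^]\<^bsub>G\<^esub> x i) {1..h}) = t0 * theta h \<chi> a \<eta> x) \<and>
        (\<forall>\<alpha>\<in>I. \<forall>\<beta>\<in>I. W \<alpha> \<beta> = t (\<beta> \<otimes>\<^bsub>G\<^esub> inv\<^bsub>G\<^esub> \<alpha>)))"


subsection \<open>Jaeger's Higman--Sims model\<close>

text \<open>
  The Higman--Sims graph is built from the 22 points and 77 blocks of the (unique) Steiner system
  \<open>S(3,6,22)\<close> and one further vertex.
\<close>

definition steiner_3_6_22 :: "nat set set \<Rightarrow> bool" where
  "steiner_3_6_22 \<B> \<longleftrightarrow>
     (\<forall>B\<in>\<B>. B \<subseteq> {0..<22} \<and> card B = 6) \<and>
     (\<forall>T. T \<subseteq> {0..<22} \<and> card T = 3 \<longrightarrow> (\<exists>!B. B \<in> \<B> \<and> T \<subseteq> B))"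

datatype hs_vertex = Infty | Point nat | Block "nat set"

definition hs_vertices :: "nat set set \<Rightarrow> hs_vertex set" where
  "hs_vertices \<B> = {Infty} \<union> Point ` {0..<22} \<union> Block ` \<B>"

fun hs_adj :: "hs_vertex \<Rightarrow> hs_vertex \<Rightarrow> bool" where
  "hs_adj Infty (Point _) \<longleftrightarrow> True"
| "hs_adj (Point _) Infty \<longleftrightarrow> True"
| "hs_adj (Point p) (Block B) \<longleftrightarrow> p \<in> B"
| "hs_adj (Block B) (Point p) \<longleftrightarrow> p \<in> B"
| "hs_adj (Block B) (Block C) \<longleftrightarrow> B \<inter> C = {}"
| "hs_adj _ _ \<longleftrightarrow> False"

definition jaeger_matrix :: "complex \<Rightarrow> hs_vertex \<Rightarrow> hs_vertex \<Rightarrow> complex" where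
  "jaeger_matrix \<tau> x y =
     (if x = y then - (\<tau> ^ 5) else if hs_adj x y then - \<tau> else inverse \<tau>)"

definition jaeger_model :: "'i set \<Rightarrow> ('i \<Rightarrow> 'i \<Rightarrow> complex) \<Rightarrow> bool" where
  "jaeger_model I W \<longleftrightarrow>
     (\<exists>\<B> \<tau>. steiner_3_6_22 \<B> \<and> \<tau> ^ 2 + inverse \<tau> ^ 2 = 3 \<and>
        same_matrix I W (hs_vertices \<B>) (jaeger_matrix \<tau>))"


subsection \<open>Spin models constructed from Hadamard matrices\<close>

text \<open>
  \<open>\<int>\<^sub>m\<close> is identified with \<open>{0, \<dots>, m - 1} :: int set\<close>, and the exponents below are
  evaluated in the integers: \<open>a\<close> raised to such an exponent depends on this choice of
  representatives.
\<close>

definition hadamard_index :: "nat \<Rightarrow> nat \<Rightarrow> (int \<times> int \<times> nat) set" where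
  "hadamard_index m r = {0..<int m} \<times> {0..<int m} \<times> {1..r}"

definition V_block ::
    "(nat \<Rightarrow> nat \<Rightarrow> complex) \<Rightarrow> complex \<Rightarrow> int \<Rightarrow> int \<Rightarrow> nat \<Rightarrow> nat \<Rightarrow> complex" where
  "V_block H u i j x y =
     (if even (i - j) then potts_matrix u x y
      else if even i then H x y
      else H y x)"

definition W_mat ::
    "nat \<Rightarrow> (nat \<Rightarrow> nat \<Rightarrow> complex) \<Rightarrow> complex \<Rightarrow> complex
     \<Rightarrow> int \<times> int \<times> nat \<Rightarrow> int \<times> int \<times> nat \<Rightarrow> complex" where
  "W_mat m H u a = (\<lambda>(i, l, x) (j, l', y).
     a powi (2 * int m * (l - l') * (i - j) + (i - j) ^ 2 + int m * (i - j)) * V_block H u i j x y)"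

definition W'_mat ::
    "(nat \<Rightarrow> nat \<Rightarrow> complex) \<Rightarrow> complex \<Rightarrow> complex \<Rightarrow> complex
     \<Rightarrow> int \<times> int \<times> nat \<Rightarrow> int \<times> int \<times> nat \<Rightarrow> complex" where
  "W'_mat H u \<eta> b = (\<lambda>(i, l, x) (j, l', y).
     \<eta> powi ((l - l') * (i - j)) * b powi ((i - j) ^ 2) * V_block H u i j x y)"

definition hadamard_model :: "'i set \<Rightarrow> ('i \<Rightarrow> 'i \<Rightarrow> complex) \<Rightarrow> bool" where
  "hadamard_model I W \<longleftrightarrow>
     (\<exists>m r H u a. m > 0 \<and> even m \<and> r > 0 \<and> hadamard r H \<and> potts_param r u \<and>
        primitive_root_of_unity (2 * m ^ 2) a \<and>
        same_matrix I W (hadamard_index m r) (W_mat m H u a))"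

definition hadamard_model' :: "'i set \<Rightarrow> ('i \<Rightarrow> 'i \<Rightarrow> complex) \<Rightarrow> bool" where
  "hadamard_model' I W \<longleftrightarrow>
     (\<exists>m r H u \<eta> b. m > 0 \<and> even m \<and> r > 0 \<and> hadamard r H \<and> potts_param r u \<and>
        primitive_root_of_unity m \<eta> \<and> b ^ (m ^ 2) = 1 \<and>
        same_matrix I W (hadamard_index m r) (W'_mat H u \<eta> b))"

definition known_spin_model :: "'i set \<Rightarrow> ('i \<Rightarrow> 'i \<Rightarrow> complex) \<Rightarrow> bool" where
  "known_spin_model I W \<longleftrightarrow>
     potts_model I W \<or> group_model I W \<or> jaeger_model I W \<or>
     hadamard_model I W \<or> hadamard_model' I W"

end

theory Submission
  imports Defs "HOL-Computational_Algebra.Primes"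
begin

text \<open>
  The moduli of the entries, normalised by the diagonal, are \<open>1, |u|^-4, |u|^-3\<close>, three distinct
  values because \<open>r > 4\<close> forces \<open>|u| \<noteq> 1\<close>. In a tensor product with these normalised moduli, exactly
  one factor has nonconstant moduli, and it takes all three values. Among the known models this
  leaves only the two Hadamard families, with the same \<open>r\<close> and some even index \<open>m'\<close>. Comparing
  sizes, \<open>m'\<close> is a proper divisor of \<open>m = 2^s\<close>, and the sizes of the other factors divide
  \<open>(m/m')^2\<close>.

  Now compare phases \<open>W(x,y)/|W(x,y)|\<close> raised to the power \<open>m^2\<close>. By the size bounds every
  factor has the same value on and off the diagonal: for group models this uses that the entries are
  a constant times \<open>2|U|\<close>-th roots of unity, for the Potts parameter that \<open>u^4 > 0\<close> or \<open>u^16 = 1\<close>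
  unless \<open>r = 3\<close>. But in \<open>W_{H,u,a}\<close> the odd blocks contain odd powers of \<open>a\<close>, and
  \<open>a^(m^2) = -1\<close>.
\<close>

section \<open>Powers, phases, and the equation z + 1/z = rho\<close>

lemma power_eq_imp_eq_exponent:
  fixes t :: real
  assumes "t > 0" "t \<noteq> 1" "t ^ i = t ^ j"
  shows "i = j"
proof -
  have "real i * ln t = real j * ln t"
    using assms by (metis ln_realpow)
  then show ?thesis using assms by simp
qed

lemma sgn_power:
  fixes z :: "'a::real_normed_div_algebra"
  shows "sgn (z ^ n) = sgn z ^ n"
  by (induction n) (simp_all add: Real_Vector_Spaces.sgn_mult)

lemma sgn_prod:
  fixes f :: "'b \<Rightarrow> 'a::{real_normed_field}"
  shows "sgn (prod f A) = (\<Prod>x\<in>A. sgn (f x))"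
  by (induction A rule: infinite_finite_induct) (simp_all add: Real_Vector_Spaces.sgn_mult)

lemma norm_root_of_unity:
  fixes z :: complex
  assumes "z ^ n = 1" "n > 0"
  shows "norm z = 1"
  using assms by (metis norm_ge_zero norm_one norm_power power_eq_1_iff less_irrefl_nat)

lemma norm_add_inverse_le:
  fixes z :: complex
  assumes "norm z = 1"
  shows "norm (z + inverse z) \<le> 2"
  using norm_triangle_ineq[of z "inverse z"] assms by (simp add: norm_inverse)

text \<open>Off the unit circle, z + 1/z can be real only if z is real. A negative real z would give
  z + 1/z at most -2, so the bound on \<open>\<rho>\<close> makes z positive.\<close>

lemma real_if_add_inverse_real:
  fixes z :: complex
  assumes "z + inverse z = of_real \<rho>" "z \<noteq> 0" "\<rho> > -2" "norm z \<noteq> 1"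
  shows "z = of_real (norm z)"
proof -
  define N where "N = (Re z)^2 + (Im z)^2"
  have N: "N = (norm z)^2" by (simp add: N_def cmod_power2)
  have N1: "N \<noteq> 1" using assms(4) N by (simp add: power2_eq_1_iff) (use norm_ge_zero[of z] in linarith)
  have N0: "N > 0" using assms(2) N by simp
  have "Im z - Im z / N = 0"
    using arg_cong[OF assms(1), of Im] by (simp add: N_def)
  then have "Im z * (N - 1) = 0" using N0 by (simp add: field_simps)
  then have im: "Im z = 0" using N1 by simp
  have re0: "Re z \<noteq> 0" using im assms(2) by (auto simp: complex_eq_iff)
  have sum: "Re z + 1 / Re z = \<rho>"
    using arg_cong[OF assms(1), of Re] re0 im by (simp add: power2_eq_square)
  have "Re z > 0"
  proof (rule ccontr)
    assume "\<not> Re z > 0"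
    then have neg: "Re z < 0" using re0 by simp
    have "Re z * (Re z + 1 / Re z) < Re z * (-2)"
      using neg sum assms(3) by (intro mult_strict_left_mono_neg) auto
    then have "Re z * Re z + 1 < - (2 * Re z)" using re0 by (simp add: algebra_simps)
    then have "(Re z + 1)^2 < 0" by (simp add: power2_eq_square algebra_simps)
    then show False by simp
  qed
  then show ?thesis using im by (simp add: complex_eq_iff cmod_eq_Re)
qed

lemma sgn_eq_1_if:
  fixes z :: complex
  assumes "z = of_real (norm z)" "z \<noteq> 0"
  shows "sgn z = 1"
  using assms by (metis divide_self_if sgn_eq)

section \<open>Modulus and phase of Potts parameters\<close>

lemma potts_param_nonzero:
  assumes "potts_param r u" "r > 0"
  shows "u \<noteq> 0"
  using assms by (auto simp: potts_param_def split: if_splits)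

lemma potts_param_fourth_power:
  assumes "potts_param r u" "r > 1"
  shows "u ^ 4 + inverse (u ^ 4) = of_real (real r - 2)"
proof -
  have "u \<noteq> 0" using potts_param_nonzero assms by fastforce
  then have "(u^2 + inverse u ^ 2)^2 = u^4 + inverse (u^4) + 2"
    by (simp add: power2_eq_square power4_eq_xxxx algebra_simps)
  then show ?thesis using assms by (simp add: potts_param_def eq_diff_eq)
qed

text \<open>For r = 1 the condition u^4 = 1 puts u on the unit circle. Otherwise u^4 + u^-4 = r - 2
  > -2, so u^4 is a positive real number.\<close>

lemma potts_param_real:
  assumes "potts_param r u" "r > 0" "norm u \<noteq> 1"
  shows "r > 1" "u ^ 4 = of_real (norm u ^ 4)"
proof -
  show r: "r > 1"
    using assms norm_root_of_unity[of u 4] by (cases "r = 1") (auto simp: potts_param_def)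
  have "norm (u ^ 4) \<noteq> 1"
    using assms(3) power_eq_1_iff[of "norm u" 4] by (auto simp: norm_power)
  then show "u ^ 4 = of_real (norm u ^ 4)"
    using real_if_add_inverse_real[OF potts_param_fourth_power[OF assms(1) r]] r
      potts_param_nonzero[OF assms(1,2)] by (simp add: norm_power)
qed

text \<open>Off the unit circle u^4 is determined by |u|, and r - 2 = u^4 + u^-4 is determined by
  u^4. This identifies the \<open>r\<close> of a tensor factor from its moduli alone.\<close>

lemma potts_param_unique_order:
  assumes "potts_param r u" "r > 0" "potts_param r' u'" "r' > 0"
    and "norm u = norm u'" "norm u \<noteq> 1"
  shows "r = r'"
proof -
  have "of_real (real r - 2) = (of_real (real r' - 2) :: complex)"
    using potts_param_real[of r u] potts_param_real[of r' u'] assms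
      potts_param_fourth_power[of r u] potts_param_fourth_power[of r' u'] by metis
  then show ?thesis by (metis add_diff_cancel_right' diff_add_cancel of_nat_eq_iff of_real_eq_iff)
qed

text \<open>On the unit circle u^4 + u^-4 has modulus at most 2, whereas it equals r - 2 >
  2.\<close>

lemma potts_param_norm_neq_1:
  assumes "potts_param r u" "r > 4"
  shows "norm u \<noteq> 1"
proof
  assume "norm u = 1"
  then have "norm (u ^ 4 + inverse (u ^ 4)) \<le> 2"
    by (intro norm_add_inverse_le) (simp add: norm_power)
  then show False
    using potts_param_fourth_power[OF assms(1)] assms(2) by (simp del: of_real_diff)
qed

text \<open>Off the unit circle u^4 > 0, so the phase is a fourth root of unity. On it only r = 1,
  2, 4 remain, with u^4 = 1, u^8 = -1 and u^4 = 1 respectively. For r = 3 the number u^4 is a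
  primitive sixth root of unity and the claim fails.\<close>

lemma potts_param_sgn:
  assumes "potts_param r u" "r > 0" "r \<noteq> 3"
  shows "sgn u ^ 16 = 1"
proof (cases "norm u = 1")
  case False
  have "u ^ 4 = of_real (norm (u ^ 4))"
    using potts_param_real(2)[OF assms(1,2) False] by (simp add: norm_power)
  then have "sgn u ^ 4 = 1"
    using sgn_eq_1_if[of "u ^ 4"] potts_param_nonzero[OF assms(1,2)] by (simp add: sgn_power)
  then have "(sgn u ^ 4) ^ 4 = 1" by simp
  then show ?thesis by (simp flip: power_mult)
next
  case True
  then have sgn: "sgn u = u" by (simp add: sgn_div_norm)
  have u0: "u \<noteq> 0" using potts_param_nonzero assms by blast
  have "r \<le> 4" using potts_param_norm_neq_1[OF assms(1)] True by fastforce
  then consider "r = 1" | "r = 2" | "r = 4" using assms by linarith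
  then have "(u ^ 4) ^ 4 = 1"
  proof cases
    case 1
    then show ?thesis using assms by (simp add: potts_param_def)
  next
    case 2
    then have "u^4 + inverse (u^4) = 0" using potts_param_fourth_power[OF assms(1)] by simp
    then have "u^4 * u^4 + 1 = 0" using u0 by (simp add: field_simps)
    then have "(u^4)^2 = -1" by (simp add: power2_eq_square eq_neg_iff_add_eq_0)
    then have "((u^4)^2)^2 = 1" by simp
    then show ?thesis by (simp flip: power_mult)
  next
    case 3
    then have "u^4 + inverse (u^4) = 2" using potts_param_fourth_power[OF assms(1)] by simp
    then have "u^4 * u^4 + 1 = 2 * u^4" using u0 by (simp add: field_simps)
    then have "(u^4 - 1)^2 = 0" by (simp add: power2_eq_square algebra_simps)
    then show ?thesis by simp
  qed
  then show ?thesis by (simp add: sgn flip: power_mult)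
qed

section \<open>Moduli and phases in the two Hadamard families\<close>

lemma power_eq_1_dvd:
  fixes z :: "'a::monoid_mult"
  assumes "z ^ n = 1" "n dvd M"
  shows "z ^ M = 1"
  using assms by (metis dvdE power_mult power_one)

lemma powi_power_eq_1:
  fixes z :: "'a::field"
  assumes "z ^ M = 1"
  shows "(z powi k) ^ M = 1"
  using assms by (metis power_int_1_left power_int_mult power_int_of_nat mult.commute)

lemma norm_powi_root_of_unity:
  fixes z :: complex
  assumes "norm z = 1"
  shows "norm (z powi k) = 1"
  using assms by (simp add: norm_power_int)

lemma norm_V_block:
  assumes "hadamard r H" "x \<in> {1..r}" "y \<in> {1..r}"
  shows "norm (V_block H u i j x y) =
    (if even (i - j) then if x = y then norm u ^ 3 else inverse (norm u) else 1)"
proof -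
  have "H x y \<in> {1,-1}" "H y x \<in> {1,-1}" using assms by (simp_all add: hadamard_def)
  then show ?thesis by (auto simp: V_block_def potts_matrix_def norm_power norm_inverse)
qed

lemma sgn_V_block_power:
  assumes "hadamard r H" "x \<in> {1..r}" "y \<in> {1..r}" "sgn u ^ M = 1" "even M"
  shows "sgn (V_block H u i j x y) ^ M = 1"
proof -
  have "sgn (u ^ 3) ^ M = 1" 
    using assms(4) by (simp add: sgn_power flip: power_mult) (metis mult.commute power_mult power_one)
  moreover have "sgn (- inverse u) ^ M = 1"
    using assms(4,5) by (simp add: sgn_minus power_inverse)
  moreover have "H x y \<in> {1,-1}" "H y x \<in> {1,-1}" using assms by (simp_all add: hadamard_def)
  ultimately show ?thesis using assms(5) 
    by (auto simp: V_block_def potts_matrix_def sgn_minus)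
qed

lemma card_hadamard_index: "card (hadamard_index m r) = m ^ 2 * r"
  by (simp add: hadamard_index_def card_cartesian_product power2_eq_square)

text \<open>The two Hadamard families differ only in the root of unity multiplying the \<open>V\<close>-block,
  which affects neither the moduli nor the \<open>M\<close>-th powers of the phases.\<close>

lemma hadamard_modelsE:
  assumes "hadamard_model I W \<or> hadamard_model' I W"
  obtains m r u where "m > 0" "even m" "r > 0" "potts_param r u" "card I = m ^ 2 * r"
    "\<And>x y. x \<in> I \<Longrightarrow> y \<in> I \<Longrightarrow>
       norm (W x y) / norm (W x x) \<in> {1, inverse (norm u) ^ 4, inverse (norm u) ^ 3}"
    "\<And>M x y. \<lbrakk>16 dvd M; 2 * m ^ 2 dvd M; r \<noteq> 3; x \<in> I; y \<in> I\<rbrakk> \<Longrightarrow> sgn (W x y) ^ M = 1"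
proof -
  obtain m r H u f c where *: "m > 0" "even m" "r > 0" "hadamard r H" "potts_param r u"
    "bij_betw f I (hadamard_index m r)"
    and W: "\<And>x y. x \<in> I \<Longrightarrow> y \<in> I \<Longrightarrow> W x y = c (f x) (f y) *
       (case f x of (i,l,x') \<Rightarrow> case f y of (j,l',y') \<Rightarrow> V_block H u i j x' y')"
    and c: "\<And>p q. norm (c p q) = 1" "\<And>p q. c p q ^ (2 * m ^ 2) = (1::complex)"
    using assms
  proof (elim disjE)
    assume "hadamard_model I W"
    then obtain m r H u a f where *: "m > 0" "even m" "r > 0" "hadamard r H" "potts_param r u"
      "bij_betw f I (hadamard_index m r)" and a: "primitive_root_of_unity (2 * m ^ 2) a"
      and W: "\<forall>x\<in>I. \<forall>y\<in>I. W x y = W_mat m H u a (f x) (f y)"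
      unfolding hadamard_model_def same_matrix_def by blast
    have a1: "a ^ (2 * m ^ 2) = 1" using a by (simp add: primitive_root_of_unity_def)
    have na: "norm a = 1" using norm_root_of_unity[OF a1] * by simp
    show ?thesis
      by (rule that[OF *, where c = "\<lambda>(i,l,x) (j,l',y). 
            a powi (2 * int m * (l - l') * (i - j) + (i - j) ^ 2 + int m * (i - j))"])
        (use W in \<open>auto simp: W_mat_def norm_powi_root_of_unity[OF na] powi_power_eq_1[OF a1]
          split: prod.splits\<close>)
  next
    assume "hadamard_model' I W"
    then obtain m r H u \<eta> b f where *: "m > 0" "even m" "r > 0" "hadamard r H" "potts_param r u"
      "bij_betw f I (hadamard_index m r)" and a: "primitive_root_of_unity m \<eta>" "b ^ (m ^ 2) = 1"
      and W: "\<forall>x\<in>I. \<forall>y\<in>I. W x y = W'_mat H u \<eta> b (f x) (f y)"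
      unfolding hadamard_model'_def same_matrix_def by blast
    have e0: "\<eta> ^ m = 1" using a by (simp add: primitive_root_of_unity_def)
    \<comment> \<open>The exponent 2m^2 is dictated by the order of \<open>a\<close> in the first
      family; the exponents m and m^2 of the second family divide it, so one bound serves
      both.\<close>
    have e1: "\<eta> ^ (2 * m ^ 2) = 1" by (rule power_eq_1_dvd[OF e0]) (simp add: power2_eq_square)
    have b1: "b ^ (2 * m ^ 2) = 1" by (rule power_eq_1_dvd[OF a(2)]) simp
    have n: "norm \<eta> = 1" "norm b = 1"
      using norm_root_of_unity[OF e1] norm_root_of_unity[OF b1] * by simp_all
    show ?thesis
      by (rule that[OF *, where c = "\<lambda>(i,l,x) (j,l',y). 
            \<eta> powi ((l - l') * (i - j)) * b powi ((i - j) ^ 2)"])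
        (use W in \<open>auto simp: W'_mat_def norm_mult norm_powi_root_of_unity n
           powi_power_eq_1[OF e1] powi_power_eq_1[OF b1] power_mult_distrib
          split: prod.splits\<close>)
  qed
  have fI: "\<exists>i l x'. f x = (i,l,x') \<and> x' \<in> {1..r}" if "x \<in> I" for x
    using bij_betwE[OF *(6)] that by (fastforce simp: hadamard_index_def)
  have u0: "norm u > 0" using potts_param_nonzero * by simp
  show ?thesis
  proof (rule that[OF *(1-3,5)])
    show "card I = m ^ 2 * r" using bij_betw_same_card[OF *(6)] card_hadamard_index by simp
  next
    fix x y assume xy: "x \<in> I" "y \<in> I"
    then obtain i l x' j l' y' where f: "f x = (i,l,x')" "f y = (j,l',y')" "x' \<in> {1..r}" "y' \<in> {1..r}"
      using fI by meson
    show "norm (W x y) / norm (W x x) \<in> {1, inverse (norm u) ^ 4, inverse (norm u) ^ 3}"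
      using xy f u0 by (simp add: W c norm_mult norm_V_block[OF *(4)] field_simps power_numeral_reduce)
  next
    fix M x y assume M: "16 dvd M" "2 * m ^ 2 dvd M" "r \<noteq> 3" and xy: "x \<in> I" "y \<in> I"
    then obtain i l x' j l' y' where f: "f x = (i,l,x')" "f y = (j,l',y')" "x' \<in> {1..r}" "y' \<in> {1..r}"
      using fI by meson
    have uM: "sgn u ^ M = 1" 
      using power_eq_1_dvd[OF potts_param_sgn M(1)] * M by blast
    have evM: "even M" using M(1) by (auto elim: dvd_trans[rotated])
    have "sgn (c p q) = c p q" for p q using c by (simp add: sgn_div_norm)
    then have "sgn (c p q) ^ M = 1" for p q using power_eq_1_dvd[OF c(2) M(2)] by simp
    then show "sgn (W x y) ^ M = 1"
      using xy f by (simp add: W Real_Vector_Spaces.sgn_mult power_mult_distrib sgn_V_block_power[OF *(4) _ _ uM evM])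
  qed
qed

section \<open>Moduli and phases of Potts and Jaeger models\<close>

lemma potts_model_moduli:
  assumes "potts_model I W"
  obtains p where "\<And>x y. x \<in> I \<Longrightarrow> y \<in> I \<Longrightarrow> norm (W x y) / norm (W x x) \<in> {1, p}"
proof -
  obtain u where u: "potts_param (card I) u" "\<forall>x\<in>I. \<forall>y\<in>I. W x y = potts_matrix u x y" 
    "card I \<ge> 2"
    using assms by (auto simp: potts_model_def)
  have "u \<noteq> 0" using potts_param_nonzero u by fastforce
  then show ?thesis
    by (intro that[of "norm (inverse u) / norm (u ^ 3)"]) (use u in \<open>auto simp: potts_matrix_def\<close>)
qed

lemma potts_model_sgn:
  assumes "potts_model I W" "card I \<noteq> 3" "16 dvd M" "x \<in> I" "y \<in> I"
  shows "sgn (W x y) ^ M = 1"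
proof -
  obtain u where u: "potts_param (card I) u" "\<forall>x\<in>I. \<forall>y\<in>I. W x y = potts_matrix u x y" 
    "card I \<ge> 2"
    using assms by (auto simp: potts_model_def)
  have uM: "sgn u ^ M = 1" 
    using power_eq_1_dvd[OF potts_param_sgn assms(3)] u assms by fastforce
  have "even M" using assms(3) by (auto elim: dvd_trans[rotated])
  have "sgn (u ^ 3) ^ M = 1" 
    using uM by (simp add: sgn_power flip: power_mult) (metis mult.commute power_mult power_one)
  moreover have "sgn (- inverse u) ^ M = 1"
    using uM \<open>even M\<close> by (simp add: sgn_minus power_inverse)
  ultimately show ?thesis using u assms by (auto simp: potts_matrix_def)
qed

text \<open>With p = 1/|tau|, the exponents come from |tau|/|tau|^5 and |tau|^-1/|tau|^5. Their
  ratio 4:6 is what later distinguishes this model from the ratio 3:4 of the Hadamard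
  families.\<close>

lemma jaeger_model_moduli:
  assumes "jaeger_model I W"
  obtains p where "p > 0" 
    "\<And>x y. x \<in> I \<Longrightarrow> y \<in> I \<Longrightarrow> norm (W x y) / norm (W x x) \<in> {1, p ^ 4, p ^ 6}"
proof -
  obtain \<tau> f where t: "\<tau> ^ 2 + inverse \<tau> ^ 2 = 3" 
    "\<forall>x\<in>I. \<forall>y\<in>I. W x y = jaeger_matrix \<tau> (f x) (f y)"
    using assms unfolding jaeger_model_def same_matrix_def by blast
  define q where "q = norm \<tau>"
  have "\<tau> \<noteq> 0" using t by auto
  then have q: "q > 0" by (simp add: q_def)
  then have "q / q ^ 5 = inverse q ^ 4" "inverse q / q ^ 5 = inverse q ^ 6"
    by (simp_all add: field_simps power_numeral_reduce)
  then show ?thesis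
    by (intro that[of "inverse q"])
      (use t q in \<open>auto simp: jaeger_matrix_def norm_power norm_inverse simp flip: q_def\<close>)
qed

text \<open>Since tau^2 + tau^-2 = 3 exceeds 2, tau^2 is off the unit circle and hence positive, so
  the phase of tau is 1 or -1.\<close>

lemma jaeger_model_sgn:
  assumes "jaeger_model I W" "even M" "x \<in> I" "y \<in> I"
  shows "sgn (W x y) ^ M = 1"
proof -
  obtain \<tau> f where t: "\<tau> ^ 2 + inverse \<tau> ^ 2 = 3" 
    "\<forall>x\<in>I. \<forall>y\<in>I. W x y = jaeger_matrix \<tau> (f x) (f y)"
    using assms unfolding jaeger_model_def same_matrix_def by blast
  have t0: "\<tau> \<noteq> 0" using t by auto
  have sum: "\<tau>^2 + inverse (\<tau>^2) = of_real 3" using t by (simp add: power_inverse)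
  have "norm (\<tau>^2) \<noteq> 1" using norm_add_inverse_le[of "\<tau>^2"] sum by auto
  then have "\<tau>^2 = of_real (norm (\<tau>^2))"
    using real_if_add_inverse_real[OF sum] t0 by simp
  then have "sgn \<tau> ^ 2 = 1" using sgn_eq_1_if[of "\<tau>^2"] t0 by (simp add: sgn_power)
  then have tM: "sgn \<tau> ^ M = 1" using power_eq_1_dvd assms(2) by blast
  then have "(sgn \<tau> ^ 5) ^ M = 1" by (metis mult.commute power_mult power_one)
  then show ?thesis using t assms tM
    by (auto simp: jaeger_matrix_def sgn_minus sgn_power power_inverse)
qed


section \<open>Entries of spin models on finite abelian groups\<close>

lemma symmetric_character_indexing_hom:
  assumes "group G" "symmetric_character_indexing G \<chi>" "c \<in> carrier G"
  shows "\<chi> c \<in> hom G complex_mult_group"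
proof -
  have "restrict (\<chi> c) (carrier G) \<in> hom G complex_mult_group"
    using assms by (auto simp: symmetric_character_indexing_def characters_def dest: bij_betwE)
  then show ?thesis
    using group.is_monoid[OF assms(1)] by (auto simp: hom_def Pi_iff monoid.m_closed)
qed

lemma character_power:
  assumes "group G" "\<phi> \<in> hom G complex_mult_group" "x \<in> carrier G"
  shows "\<phi> (x [^]\<^bsub>G\<^esub> (n::nat)) = \<phi> x ^ n"
proof -
  interpret group G by fact
  have mult: "\<phi> (y \<otimes>\<^bsub>G\<^esub> z) = \<phi> y * \<phi> z" and nz: "\<phi> y \<noteq> 0"
    if "y \<in> carrier G" "z \<in> carrier G" for y z
    using assms(2) that by (auto simp: hom_def complex_mult_group_def)
  have "\<phi> \<one>\<^bsub>G\<^esub> * \<phi> \<one>\<^bsub>G\<^esub> = \<phi> \<one>\<^bsub>G\<^esub>"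
    using mult[of "\<one>\<^bsub>G\<^esub>" "\<one>\<^bsub>G\<^esub>"] by simp
  then have "\<phi> \<one>\<^bsub>G\<^esub> = 1" using nz[of "\<one>\<^bsub>G\<^esub>" "\<one>\<^bsub>G\<^esub>"] by simp
  then show ?thesis by (induction n) (simp_all add: mult assms(3) mult.commute)
qed

text \<open>The function \<open>t\<close> of a group model is prescribed only at products with
  exponent vectors in \<open>E\<close>; surjectivity of the decomposition shows that these are all
  group elements.\<close>

lemma cyclic_decomposition_exponents:
  fixes G (structure)
  assumes "comm_group G" "finite (carrier G)" "cyclic_decomposition G h a" "g \<in> carrier G"
    and n: "\<forall>i\<in>{1..h}. n i = group.ord G (a i)"
  shows "\<exists>x \<in> (\<Pi>\<^sub>E i\<in>{1..h}. {0..<n i}). g = finprod G (\<lambda>i. a i [^] x i) {1..h}"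
proof -
  interpret comm_group G by fact
  have a: "a i \<in> carrier G" if "i \<in> {1..h}" for i
    using assms(3) that by (auto simp: cyclic_decomposition_def)
  have "bij_betw (\<lambda>x. finprod G x {1..h})
      (\<Pi>\<^sub>E i\<in>{1..h}. carrier (subgroup_generated G {a i})) (carrier G)"
    using assms(3) by (auto simp: cyclic_decomposition_def iso_def carrier_product_group)
  then obtain y where y: "y \<in> (\<Pi>\<^sub>E i\<in>{1..h}. carrier (subgroup_generated G {a i}))"
      "g = finprod G y {1..h}"
    using assms(4) by (auto simp: bij_betw_def)
  have "\<exists>k<n i. y i = a i [^] k" if i: "i \<in> {1..h}" for i
  proof -
    have "y i \<in> range (\<lambda>k::int. a i [^] k)"
      using PiE_mem[OF y(1) i] carrier_subgroup_generated_by_singleton[OF a[OF i]] by simp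
    then obtain k :: int where k: "y i = a i [^] k" by auto
    have pos: "ord (a i) > 0" using ord_ge_1[OF assms(2) a[OF i]] by simp
    \<comment> \<open>Reducing modulo the order moves the integer exponent into the range required
      by \<open>E\<close>.\<close>
    have "a i [^] k = a i [^] (k mod int (ord (a i)))"
      using int_pow_eq[OF a[OF i]] by (simp add: mod_eq_dvd_iff flip: mod_eq_dvd_iff)
    also have "\<dots> = a i [^] nat (k mod int (ord (a i)))"
      using pos by (simp flip: int_pow_int)
    finally show ?thesis
      using k pos n i by (intro exI[of _ "nat (k mod int (ord (a i)))"]) (simp add: nat_less_iff)
  qed
  then obtain x where x: "\<And>i. i \<in> {1..h} \<Longrightarrow> x i < n i \<and> y i = a i [^] x i" by metis
  show ?thesis
  proof (rule bexI[of _ "restrict x {1..h}"])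
    show "g = finprod G (\<lambda>i. a i [^] restrict x {1..h} i) {1..h}"
      unfolding y(2) using x a by (intro finprod_cong') auto
  qed (use x in auto)
qed

text \<open>The values of \<open>\<chi>\<close> at generators are roots of unity of order dividing
  some n_i, which divides |G|. The factor 2 is due to \<open>\<eta>\<close>: its n_i-th power is
  only known to square to 1.\<close>

lemma theta_power:
  assumes "comm_group G" "finite (carrier G)" "cyclic_decomposition G h a"
    and n: "\<forall>i\<in>{1..h}. n i = group.ord G (a i)"
    and "symmetric_character_indexing G \<chi>"
    and \<eta>: "\<forall>i\<in>{1..h}. \<eta> i ^ n i = inverse (\<chi> (a i) (a i) ^ (n i * (n i - 1) div 2))"
  shows "theta h \<chi> a \<eta> x ^ (2 * card (carrier G)) = 1"
proof -
  interpret comm_group G by fact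
  have a: "a i \<in> carrier G" if "i \<in> {1..h}" for i
    using assms(3) that by (auto simp: cyclic_decomposition_def)
  have one: "\<phi> \<one>\<^bsub>G\<^esub> = 1" if "\<phi> \<in> hom G complex_mult_group" for \<phi>
    using character_power[OF is_group that one_closed, of 0] by simp
  let ?N = "2 * card (carrier G)"
  have dvd: "n i dvd ?N" if "i \<in> {1..h}" for i
    using ord_dvd_group_order[OF a[OF that]] n that by (simp add: order_def)
  have chi_n: "\<chi> (a i) (a k) ^ n k = 1" if "i \<in> {1..h}" "k \<in> {1..h}" for i k
    using character_power[OF is_group symmetric_character_indexing_hom[OF is_group assms(5)], of "a i" "a k" "n k"]
      one[OF symmetric_character_indexing_hom[OF is_group assms(5)]] a n that pow_ord_eq_1 by metis
  have chi: "\<chi> (a i) (a k) ^ ?N = 1" if "i \<in> {1..h}" "k \<in> {1..h}" for i k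
    using power_eq_1_dvd[OF chi_n dvd] that by blast
  have eta: "\<eta> i ^ ?N = 1" if i: "i \<in> {1..h}" for i
  proof -
    \<comment> \<open>The halved exponent is exact, so squaring restores n_i (n_i - 1), a multiple
      of n_i.\<close>
    have "even (n i * (n i - 1))" by (cases "even (n i)") auto
    then have "(\<chi> (a i) (a i) ^ (n i * (n i - 1) div 2)) ^ 2 = \<chi> (a i) (a i) ^ (n i * (n i - 1))"
      by (metis dvd_div_mult_self power_mult)
    also have "\<dots> = 1" using chi_n[OF i i] by (simp add: power_mult)
    finally have "(\<eta> i ^ n i)^2 = 1" using \<eta> i by (simp add: power_inverse)
    then have "\<eta> i ^ (n i * 2) = 1" by (simp add: power_mult)
    moreover have "n i * 2 dvd ?N"
      using ord_dvd_group_order[OF a[OF i]] n i by (simp add: order_def)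
    ultimately show ?thesis by (rule power_eq_1_dvd)
  qed
  have pow: "(z ^ k) ^ ?N = 1" if "z ^ ?N = 1" for z :: complex and k
    using that by (metis mult.commute power_mult power_one)
  show ?thesis
    unfolding theta_def
    by (simp add: power_mult_distrib prod_power_distrib pow[OF eta] pow[OF chi])
qed

text \<open>Each entry is \<open>t0\<close> times a root of unity of order dividing 2|I|. Comparing
  with the diagonal eliminates \<open>t0\<close>; in particular all entries have the same
  modulus.\<close>

lemma group_model_power:
  fixes W :: "'i \<Rightarrow> 'i \<Rightarrow> complex"
  assumes "group_model I W" "x \<in> I" "y \<in> I"
  shows "W x y ^ (2 * card I) = W x x ^ (2 * card I)"
proof -
  obtain G :: "'i monoid" and h a n E \<chi> \<eta> and D :: real and t0 t where
    G: "comm_group G" "finite (carrier G)" "carrier G = I" "cyclic_decomposition G h a"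
    and n: "\<forall>i\<in>{1..h}. n i = group.ord G (a i)"
    and E: "E = (\<Pi>\<^sub>E i\<in>{1..h}. {0..<n i})"
    and \<chi>: "symmetric_character_indexing G \<chi>"
    and \<eta>: "\<forall>i\<in>{1..h}. \<eta> i ^ n i = inverse (\<chi> (a i) (a i) ^ (n i * (n i - 1) div 2))"
    and t: "\<forall>x\<in>E. t (finprod G (\<lambda>i. a i [^]\<^bsub>G\<^esub> x i) {1..h}) = t0 * theta h \<chi> a \<eta> x"
    and W: "\<forall>\<alpha>\<in>I. \<forall>\<beta>\<in>I. W \<alpha> \<beta> = t (\<beta> \<otimes>\<^bsub>G\<^esub> inv\<^bsub>G\<^esub> \<alpha>)"
    using assms(1) unfolding group_model_def by blast
  interpret comm_group G by fact
  have "t g ^ (2 * card I) = t0 ^ (2 * card I)" if "g \<in> I" for g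
  proof -
    have "g \<in> carrier G" using that G(3) by simp
    then obtain e where "e \<in> E" "g = finprod G (\<lambda>i. a i [^]\<^bsub>G\<^esub> e i) {1..h}"
      by (rule bexE[OF cyclic_decomposition_exponents[OF G(1,2,4) _ n, folded E]])
    then show ?thesis
      using t theta_power[OF G(1,2,4) n \<chi> \<eta>] G(3) by (simp add: power_mult_distrib)
  qed
  moreover have "y \<otimes>\<^bsub>G\<^esub> inv\<^bsub>G\<^esub> x \<in> I" "x \<otimes>\<^bsub>G\<^esub> inv\<^bsub>G\<^esub> x \<in> I"
    using assms G(3) by auto
  ultimately show ?thesis using W assms by simp
qed


section \<open>Constraints valid for every known spin model\<close>

text \<open>The values 1, t^4, t^3 with t = 1/|u| are distinct. Potts models have too few moduli,
  group models have constant modulus, and for Jaeger's model the exponents do not match, so only the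
  Hadamard families survive.\<close>

lemma known_spin_model_of_two_moduli:
  assumes "known_spin_model I W" "potts_param r u" "r > 0" "norm u \<noteq> 1"
    and ex4: "\<exists>x\<in>I. \<exists>y\<in>I. norm (W x y) / norm (W x x) = inverse (norm u) ^ 4"
    and ex3: "\<exists>x\<in>I. \<exists>y\<in>I. norm (W x y) / norm (W x x) = inverse (norm u) ^ 3"
  obtains m where "m > 0" "even m" "card I = m ^ 2 * r"
    "\<And>M x y. \<lbrakk>16 dvd M; 2 * m ^ 2 dvd M; r \<noteq> 3; x \<in> I; y \<in> I\<rbrakk> \<Longrightarrow> sgn (W x y) ^ M = 1"
proof -
  define t where "t = inverse (norm u)"
  have t: "t > 0" "t \<noteq> 1"
    using potts_param_nonzero[OF assms(2,3)] assms(4) by (simp_all add: t_def)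
  have attained: "t ^ 4 \<in> A" "t ^ 3 \<in> A"
    if "\<And>x y. x \<in> I \<Longrightarrow> y \<in> I \<Longrightarrow> norm (W x y) / norm (W x x) \<in> A" for A
    using that ex4 ex3 unfolding t_def by metis+
  note inj = power_eq_imp_eq_exponent[OF t]
  have neq: "t ^ 4 \<noteq> 1" "t ^ 3 \<noteq> 1" "t ^ 4 \<noteq> t ^ 3" using inj[of 4 0] inj[of 3 0] inj[of 4 3] by auto
  have "\<not> potts_model I W"
  proof
    assume "potts_model I W"
    then obtain p where
      "\<And>x y. x \<in> I \<Longrightarrow> y \<in> I \<Longrightarrow> norm (W x y) / norm (W x x) \<in> {1, p}"
      using potts_model_moduli by metis
    from attained[OF this] show False using neq by auto
  qed
  moreover have "\<not> group_model I W"
  proof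
    assume g: "group_model I W"
    \<comment> \<open>The value 0 covers a vanishing diagonal entry, since division by zero yields
      0; it is excluded by t > 0.\<close>
    have "norm (W x y) / norm (W x x) \<in> {0, 1}" if "x \<in> I" "y \<in> I" for x y
    proof -
      have "card I > 0" using g that by (auto simp: group_model_def card_gt_0_iff)
      moreover have "norm (W x y) ^ (2 * card I) = norm (W x x) ^ (2 * card I)"
        using group_model_power[OF g that] by (metis norm_power)
      ultimately have "norm (W x y) = norm (W x x)" by (simp add: power_eq_iff_eq_base)
      then show ?thesis by simp
    qed
    from attained(1)[OF this] show False using neq t by auto
  qed
  moreover have "\<not> jaeger_model I W"
  proof
    assume "jaeger_model I W"
    then obtain p where p: "p > 0"
      "\<And>x y. x \<in> I \<Longrightarrow> y \<in> I \<Longrightarrow> norm (W x y) / norm (W x x) \<in> {1, p ^ 4, p ^ 6}"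
      using jaeger_model_moduli by metis
    from attained[OF p(2)] neq
    consider "t ^ 4 = p ^ 4" "t ^ 3 = p ^ 6" | "t ^ 4 = p ^ 6" "t ^ 3 = p ^ 4" by auto
    then show False
    proof cases
      case 1
      then have "t = p" using t p(1) by (simp add: power_eq_iff_eq_base)
      then show False using 1 inj[of 3 6] by simp
    next
      case 2
      \<comment> \<open>Both sides equal p^12.\<close>
      have "t ^ 8 = (t ^ 4) ^ 2" "t ^ 9 = (t ^ 3) ^ 3" by (simp_all flip: power_mult)
      then have "t ^ 8 = t ^ 9" using 2 by (simp flip: power_mult)
      then show False using inj[of 8 9] by simp
    qed
  qed
  ultimately have "hadamard_model I W \<or> hadamard_model' I W"
    using assms(1) by (auto simp: known_spin_model_def)
  then obtain m r' u' where *: "m > 0" "even m" "r' > 0" "potts_param r' u'" "card I = m ^ 2 * r'"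
    and val: "\<And>x y. x \<in> I \<Longrightarrow> y \<in> I \<Longrightarrow>
       norm (W x y) / norm (W x x) \<in> {1, inverse (norm u') ^ 4, inverse (norm u') ^ 3}"
    and sgn: "\<And>M x y. \<lbrakk>16 dvd M; 2 * m ^ 2 dvd M; r' \<noteq> 3; x \<in> I; y \<in> I\<rbrakk> \<Longrightarrow> sgn (W x y) ^ M = 1"
    by (rule hadamard_modelsE) blast
  define p where "p = inverse (norm u')"
  have p: "p > 0" using potts_param_nonzero[OF *(4,3)] by (simp add: p_def)
  from attained[OF val] neq
  \<comment> \<open>The two moduli could be matched in swapped order; then t^16 = p^12 = t^9, which
    is impossible for positive t other than 1.\<close>
  consider "t ^ 4 = p ^ 4" | "t ^ 4 = p ^ 3" "t ^ 3 = p ^ 4" by (auto simp: p_def)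
  then have "t = p"
  proof cases
    case 1
    then show ?thesis using t p by (simp add: power_eq_iff_eq_base)
  next
    case 2
    have "t ^ 16 = (t ^ 4) ^ 4" "t ^ 9 = (t ^ 3) ^ 3" by (simp_all flip: power_mult)
    then have "t ^ 16 = t ^ 9" using 2 by (simp flip: power_mult)
    then show ?thesis using inj[of 16 9] by simp
  qed
  then have "norm u = norm u'" by (simp add: t_def p_def)
  then have "r = r'"
    using potts_param_unique_order assms(2-4) *(3,4) by blast
  then show ?thesis using that[OF *(1,2)] *(5) sgn by blast
qed

text \<open>The phase condition for the factors other than the distinguished one. It compares with
  the diagonal because the phase of \<open>t0\<close> in a group model is not controlled. In the
  Hadamard case |I| = m^2 r, so the divisibility hypotheses give 2m^2 | M and exclude r = 3.\<close>

lemma known_spin_model_sgn: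
  assumes "known_spin_model I W" "16 dvd M" "2 * card I dvd M" "\<not> 3 dvd card I" "x \<in> I" "y \<in> I"
  shows "sgn (W x y) ^ M = sgn (W x x) ^ M"
proof -
  have evM: "even M" using assms(2) by (auto elim: dvd_trans[rotated])
  consider "potts_model I W" | "group_model I W" | "jaeger_model I W"
    | "hadamard_model I W \<or> hadamard_model' I W"
    using assms(1) by (auto simp: known_spin_model_def)
  then show ?thesis
  proof cases
    case 1
    have "card I \<noteq> 3" using assms(4) by auto
    then show ?thesis using potts_model_sgn[OF 1 _ assms(2)] assms by simp
  next
    case 2
    obtain c where "M = 2 * card I * c" using assms(3) by auto
    then have "W x y ^ M = W x x ^ M" using group_model_power[OF 2 assms(5,6)] by (simp add: power_mult)
    then show ?thesis by (metis sgn_power)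
  next
    case 3
    then show ?thesis using jaeger_model_sgn evM assms by metis
  next
    case 4
    then obtain m r where *: "card I = m ^ 2 * r"
      "\<And>M x y. \<lbrakk>16 dvd M; 2 * m ^ 2 dvd M; r \<noteq> 3; x \<in> I; y \<in> I\<rbrakk> \<Longrightarrow> sgn (W x y) ^ M = 1"
      by (rule hadamard_modelsE) blast
    have "r \<noteq> 3" using assms(4) *(1) by auto
    moreover have "2 * m ^ 2 dvd M" using assms(3) *(1) by (metis dvd_mult_left mult.assoc)
    ultimately show ?thesis using * assms by simp
  qed
qed

section \<open>Moduli in a tensor product\<close>

lemma tensor_index_upd:
  assumes "p \<in> tensor_index v I" "k \<in> {1..v}" "x \<in> I k"
  shows "p(k := x) \<in> tensor_index v I"
  using assms by (auto simp: tensor_index_def PiE_iff extensional_def)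

lemma norm_tensor_ratio:
  "norm (tensor v W \<alpha> \<beta>) / norm (tensor v W \<alpha> \<alpha>) =
     (\<Prod>k\<in>{1..v}. norm (W k (\<alpha> k) (\<beta> k)) / norm (W k (\<alpha> k) (\<alpha> k)))"
  by (simp add: tensor_def prod_norm prod_dividef)

text \<open>The set \<open>{1, t^4, t^3}\<close> has no two elements other than \<open>1\<close> with product in the set,
  so two tensor factors cannot both have nonconstant moduli.\<close>

lemma tensor_factor_of_two_moduli:
  fixes W :: "nat \<Rightarrow> 'i \<Rightarrow> 'i \<Rightarrow> complex"
  assumes nz: "\<And>\<alpha> \<beta>. \<lbrakk>\<alpha> \<in> tensor_index v I; \<beta> \<in> tensor_index v I\<rbrakk> \<Longrightarrow> tensor v W \<alpha> \<beta> \<noteq> 0"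
    and val: "\<And>\<alpha> \<beta>. \<lbrakk>\<alpha> \<in> tensor_index v I; \<beta> \<in> tensor_index v I\<rbrakk> \<Longrightarrow>
          norm (tensor v W \<alpha> \<beta>) / norm (tensor v W \<alpha> \<alpha>) \<in> {1, t ^ 4, t ^ 3}"
    and t: "t > 0" "t \<noteq> 1"
    and ex4: "\<exists>\<alpha>\<in>tensor_index v I. \<exists>\<beta>\<in>tensor_index v I.
          norm (tensor v W \<alpha> \<beta>) / norm (tensor v W \<alpha> \<alpha>) = t ^ 4"
    and ex3: "\<exists>\<alpha>\<in>tensor_index v I. \<exists>\<beta>\<in>tensor_index v I.
          norm (tensor v W \<alpha> \<beta>) / norm (tensor v W \<alpha> \<alpha>) = t ^ 3"
  obtains k where "k \<in> {1..v}"
    "\<exists>x\<in>I k. \<exists>y\<in>I k. norm (W k x y) / norm (W k x x) = t ^ 4"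
    "\<exists>x\<in>I k. \<exists>y\<in>I k. norm (W k x y) / norm (W k x x) = t ^ 3"
proof -
  define T where "T = tensor_index v I"
  define R where "R k x y = norm (W k x y) / norm (W k x x)" for k x y
  note inj = power_eq_imp_eq_exponent[OF t]
  note exR = ex4[folded T_def, unfolded norm_tensor_ratio, folded R_def]
    ex3[folded T_def, unfolded norm_tensor_ratio, folded R_def]
  \<comment> \<open>A base point: changing one or two of its coordinates isolates the contribution
    of one or two factors.\<close>
  obtain p where p: "p \<in> T" using ex4 T_def by blast
  have pk: "p k \<in> I k" if "k \<in> {1..v}" for k
    using p that by (auto simp: T_def tensor_index_def)
  \<comment> \<open>Nonvanishing of the tensor product is essential here, as the quotient would be 0
    at a zero diagonal entry.\<close>
  have R_refl: "R k x x = 1" if "k \<in> {1..v}" "x \<in> I k" for k x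
  proof -
    have "tensor v W (p(k := x)) (p(k := x)) \<noteq> 0"
      using nz tensor_index_upd[OF p[unfolded T_def] that] by simp
    then have "(\<Prod>i\<in>{1..v}. W i ((p(k := x)) i) ((p(k := x)) i)) \<noteq> 0" by (simp only: tensor_def not_False_eq_True)
    then have "W k ((p(k := x)) k) ((p(k := x)) k) \<noteq> 0"
      using that(1) by (metis finite_atLeastAtMost prod_zero)
    then have "W k x x \<noteq> 0" by simp
    then show ?thesis by (simp add: R_def)
  qed
  have valR: "(\<Prod>k\<in>{1..v}. R k (\<alpha> k) (\<beta> k)) \<in> {1, t ^ 4, t ^ 3}" if "\<alpha> \<in> T" "\<beta> \<in> T" for \<alpha> \<beta>
    using val[of \<alpha> \<beta>] that by (simp only: T_def norm_tensor_ratio R_def)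
  have one: "R k x y \<in> {1, t ^ 4, t ^ 3}" if k: "k \<in> {1..v}" and xy: "x \<in> I k" "y \<in> I k" for k x y
  proof -
    let ?\<alpha> = "p(k := x)" and ?\<beta> = "p(k := y)"
    have "(\<Prod>i\<in>{1..v}. R i (?\<alpha> i) (?\<beta> i)) = R k x y * (\<Prod>i\<in>{1..v}-{k}. R i (?\<alpha> i) (?\<beta> i))"
      using k by (subst prod.remove[of _ k]) auto
    also have "(\<Prod>i\<in>{1..v}-{k}. R i (?\<alpha> i) (?\<beta> i)) = 1"
      using R_refl pk by (intro prod.neutral) auto
    finally show ?thesis
      using valR[of ?\<alpha> ?\<beta>] tensor_index_upd p k xy unfolding T_def by (metis mult.right_neutral)
  qed
  have two: "R k x y * R l x' y' \<in> {1, t ^ 4, t ^ 3}"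
    if k: "k \<in> {1..v}" "l \<in> {1..v}" "k \<noteq> l" and xy: "x \<in> I k" "y \<in> I k" "x' \<in> I l" "y' \<in> I l"
    for k l x y x' y'
  proof -
    let ?\<alpha> = "p(k := x, l := x')" and ?\<beta> = "p(k := y, l := y')"
    have "(\<Prod>i\<in>{1..v}. R i (?\<alpha> i) (?\<beta> i)) =
        R k x y * (R l x' y' * (\<Prod>i\<in>{1..v}-{k}-{l}. R i (?\<alpha> i) (?\<beta> i)))"
      using k by (subst prod.remove[of _ k], simp, simp, subst prod.remove[of _ l]) auto
    also have "(\<Prod>i\<in>{1..v}-{k}-{l}. R i (?\<alpha> i) (?\<beta> i)) = 1"
      using R_refl pk by (intro prod.neutral) auto
    finally have "(\<Prod>i\<in>{1..v}. R i (?\<alpha> i) (?\<beta> i)) = R k x y * R l x' y'"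
      by (simp only: mult_1_right)
    moreover have "?\<alpha> \<in> T" "?\<beta> \<in> T"
      using tensor_index_upd p k xy unfolding T_def by (metis (no_types, lifting))+
    ultimately show ?thesis using valR by metis
  qed
  have "t ^ 4 \<noteq> 1" "t ^ 3 \<noteq> 1" using inj[of 4 0] inj[of 3 0] by auto
  obtain \<alpha> \<beta> where \<alpha>: "\<alpha> \<in> T" "\<beta> \<in> T" "(\<Prod>k\<in>{1..v}. R k (\<alpha> k) (\<beta> k)) = t ^ 4"
    using exR(1) by blast
  have "\<not> (\<forall>k\<in>{1..v}. R k (\<alpha> k) (\<beta> k) = 1)"
    using prod.neutral[of "{1..v}" "\<lambda>k. R k (\<alpha> k) (\<beta> k)"] \<alpha>(3) \<open>t ^ 4 \<noteq> 1\<close> by argo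
  then obtain k where k: "k \<in> {1..v}" "R k (\<alpha> k) (\<beta> k) \<noteq> 1" by blast
  have \<alpha>k: "\<alpha> k \<in> I k" "\<beta> k \<in> I k"
    using \<alpha>(1,2) k(1) by (auto simp: T_def tensor_index_def)
  have flat: "R l x y = 1" if "l \<in> {1..v}" "l \<noteq> k" "x \<in> I l" "y \<in> I l" for l x y
  proof (rule ccontr)
    assume "R l x y \<noteq> 1"
    then have "R k (\<alpha> k) (\<beta> k) * R l x y \<in> {t ^ 8, t ^ 7, t ^ 6}"
      using one[OF k(1) \<alpha>k] one[OF that(1,3,4)] k(2) by (auto simp flip: power_add)
    \<comment> \<open>Writing 1 as \<open>t ^ 0\<close> lets \<open>inj\<close> compare all
      exponents uniformly: a sum of two numbers from {3, 4} is never 0, 3 or 4.\<close>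
    moreover have "R k (\<alpha> k) (\<beta> k) * R l x y \<in> {t ^ 0, t ^ 4, t ^ 3}"
      using two[OF k(1) that(1) _ \<alpha>k that(3,4)] that(2) by simp
    ultimately have "{t ^ 8, t ^ 7, t ^ 6} \<inter> {t ^ 0, t ^ 4, t ^ 3} \<noteq> {}" by blast
    then show False by (auto simp del: power_0 dest!: inj)
  qed
  have "\<exists>x\<in>I k. \<exists>y\<in>I k. R k x y = c"
    if ex: "\<exists>\<alpha>\<in>T. \<exists>\<beta>\<in>T. (\<Prod>i\<in>{1..v}. R i (\<alpha> i) (\<beta> i)) = c" for c
  proof -
    obtain \<alpha> \<beta> where \<alpha>: "\<alpha> \<in> T" "\<beta> \<in> T" "(\<Prod>i\<in>{1..v}. R i (\<alpha> i) (\<beta> i)) = c"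
      using ex by blast
    have mem: "\<alpha> i \<in> I i" "\<beta> i \<in> I i" if "i \<in> {1..v}" for i
      using \<alpha>(1,2) that by (auto simp: T_def tensor_index_def)
    have "(\<Prod>i\<in>{1..v}-{k}. R i (\<alpha> i) (\<beta> i)) = 1"
      using flat mem by (intro prod.neutral) auto
    then have "R k (\<alpha> k) (\<beta> k) = c"
      using \<alpha>(3) k(1) by (subst (asm) prod.remove[of _ k]) auto
    then show ?thesis using mem k(1) by blast
  qed
  from this[OF exR(1)] this[OF exR(2)] show ?thesis
    by (rule that[OF k(1), folded R_def])
qed

section \<open>Divisibility of sizes and the phase contradiction\<close>

theorem theorem1p3:
  fixes s m r :: nat and H :: "nat \<Rightarrow> nat \<Rightarrow> complex" and u a :: complex
  assumes "s \<ge> 1" and "m = 2 ^ s" and "r > 4"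
    and "hadamard r H"
    and "(u ^ 2 + inverse u ^ 2) ^ 2 = of_nat r"
    and "primitive_root_of_unity (2 * m ^ 2) a"
  shows "\<not> (\<exists>(v :: nat) (I :: nat \<Rightarrow> 'i set) (W :: nat \<Rightarrow> 'i \<Rightarrow> 'i \<Rightarrow> complex).
             v \<ge> 2 \<and>
             (\<forall>k\<in>{1..v}. card (I k) > 1 \<and> known_spin_model (I k) (W k)) \<and>
             same_matrix (hadamard_index m r) (W_mat m H u a) (tensor_index v I) (tensor v W))"
proof
  assume "\<exists>(v :: nat) (I :: nat \<Rightarrow> 'i set) (W :: nat \<Rightarrow> 'i \<Rightarrow> 'i \<Rightarrow> complex).
             v \<ge> 2 \<and>
             (\<forall>k\<in>{1..v}. card (I k) > 1 \<and> known_spin_model (I k) (W k)) \<and>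
             same_matrix (hadamard_index m r) (W_mat m H u a) (tensor_index v I) (tensor v W)"
  then obtain v and I :: "nat \<Rightarrow> 'i set" and W :: "nat \<Rightarrow> 'i \<Rightarrow> 'i \<Rightarrow> complex" and f
    where v: "v \<ge> 2"
    and fac: "\<And>k. k \<in> {1..v} \<Longrightarrow> card (I k) > 1" "\<And>k. k \<in> {1..v} \<Longrightarrow> known_spin_model (I k) (W k)"
    and bij: "bij_betw f (hadamard_index m r) (tensor_index v I)"
    and eq: "\<And>x y. \<lbrakk>x \<in> hadamard_index m r; y \<in> hadamard_index m r\<rbrakk> \<Longrightarrow>
        W_mat m H u a x y = tensor v W (f x) (f y)"
    unfolding same_matrix_def by blast
  let ?X = "hadamard_index m r" and ?T = "tensor_index v I"
  define t where "t = inverse (norm u)"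
  have u: "potts_param r u" using assms by (simp add: potts_param_def)
  have r0: "r > 0" using assms(3) by simp
  have u0: "norm u > 0" using potts_param_nonzero[OF u r0] by simp
  have u1: "norm u \<noteq> 1" using potts_param_norm_neq_1[OF u] assms by simp
  have m2: "m \<ge> 2" "even m" using assms(1,2) by (auto simp: self_le_power)
  have t: "t > 0" "t \<noteq> 1" using u0 u1 by (simp_all add: t_def)
  have a: "a ^ (2 * m ^ 2) = 1" "a ^ (m ^ 2) \<noteq> 1"
    using assms(6) m2 by (auto simp: primitive_root_of_unity_def)
  have na: "norm a = 1" using norm_root_of_unity[OF a(1)] m2 by simp
  have norm_W: "norm (W_mat m H u a (i,l,x) (j,l',y)) =
      (if even (i - j) then if x = y then norm u ^ 3 else inverse (norm u) else 1)"
    if "(i,l,x) \<in> ?X" "(j,l',y) \<in> ?X" for i l x j l' y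
    using that norm_V_block[OF assms(4)]
    by (simp add: W_mat_def norm_mult norm_powi_root_of_unity[OF na] hadamard_index_def)
  have ratio_W: "norm (W_mat m H u a (i,l,x) (j,l',y)) / norm (W_mat m H u a (i,l,x) (i,l,x)) =
      (if even (i - j) then if x = y then 1 else t ^ 4 else t ^ 3)"
    if "(i,l,x) \<in> ?X" "(j,l',y) \<in> ?X" for i l x j l' y
    using norm_W that u0 by (simp add: t_def field_simps power_numeral_reduce)
  \<comment> \<open>Witnesses for the moduli: the first two points give an off-diagonal entry of an
    even block, ratio t^4; the first and third lie across an odd block, ratio t^3.\<close>
  have pts: "(0,0,1) \<in> ?X" "(0,0,2) \<in> ?X" "(1,0,1) \<in> ?X"
    using m2 assms(3) by (auto simp: hadamard_index_def)
  have T: "\<exists>x\<in>?X. f x = \<alpha>" if "\<alpha> \<in> ?T" for \<alpha>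
    using bij that by (metis bij_betw_imp_surj_on imageE)
  have fT: "f x \<in> ?T" if "x \<in> ?X" for x using bij that by (metis bij_betwE)
  have nz: "tensor v W \<alpha> \<beta> \<noteq> 0" if "\<alpha> \<in> ?T" "\<beta> \<in> ?T" for \<alpha> \<beta>
  proof -
    obtain x y where xy: "x \<in> ?X" "y \<in> ?X" "f x = \<alpha>" "f y = \<beta>" using T \<open>\<alpha> \<in> ?T\<close> \<open>\<beta> \<in> ?T\<close> by blast
    have "norm (W_mat m H u a x y) > 0"
      using norm_W u0 xy by (cases x; cases y) auto
    then show ?thesis using eq xy by auto
  qed
  have val: "norm (tensor v W \<alpha> \<beta>) / norm (tensor v W \<alpha> \<alpha>) \<in> {1, t ^ 4, t ^ 3}"
    if "\<alpha> \<in> ?T" "\<beta> \<in> ?T" for \<alpha> \<beta>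
  proof -
    obtain x y where xy: "x \<in> ?X" "y \<in> ?X" "f x = \<alpha>" "f y = \<beta>" using T \<open>\<alpha> \<in> ?T\<close> \<open>\<beta> \<in> ?T\<close> by blast
    have "norm (W_mat m H u a x y) / norm (W_mat m H u a x x) \<in> {1, t ^ 4, t ^ 3}"
      using ratio_W xy by (cases x; cases y) auto
    then show ?thesis using eq xy by metis
  qed
  have ex4: "\<exists>\<alpha>\<in>?T. \<exists>\<beta>\<in>?T. norm (tensor v W \<alpha> \<beta>) / norm (tensor v W \<alpha> \<alpha>) = t ^ 4"
    using ratio_W[OF pts(1,2)] fT eq pts by (intro bexI[of _ "f (0,0,1)"] bexI[of _ "f (0,0,2)"]) auto
  have ex3: "\<exists>\<alpha>\<in>?T. \<exists>\<beta>\<in>?T. norm (tensor v W \<alpha> \<beta>) / norm (tensor v W \<alpha> \<alpha>) = t ^ 3"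
    using ratio_W[OF pts(1,3)] fT eq pts by (intro bexI[of _ "f (0,0,1)"] bexI[of _ "f (1,0,1)"]) auto
  obtain k where k: "k \<in> {1..v}"
    "\<exists>x\<in>I k. \<exists>y\<in>I k. norm (W k x y) / norm (W k x x) = t ^ 4"
    "\<exists>x\<in>I k. \<exists>y\<in>I k. norm (W k x y) / norm (W k x x) = t ^ 3"
    using tensor_factor_of_two_moduli[OF nz val t ex4 ex3] by metis
  obtain m' where m': "m' > 0" "even m'" "card (I k) = m' ^ 2 * r"
    and sgn_k: "\<And>M x y. \<lbrakk>16 dvd M; 2 * m' ^ 2 dvd M; r \<noteq> 3; x \<in> I k; y \<in> I k\<rbrakk> \<Longrightarrow> sgn (W k x y) ^ M = 1"
    by (rule known_spin_model_of_two_moduli[OF fac(2)[OF k(1)] u r0 u1 k(2,3)[unfolded t_def]]) blast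
  \<comment> \<open>The joint size of the remaining factors. As m is a power of 2 and v is at least
    2, it turns out to be a nontrivial power of 2.\<close>
  define C where "C = (\<Prod>l\<in>{1..v}-{k}. card (I l))"
  have "m ^ 2 * r = (\<Prod>l\<in>{1..v}. card (I l))"
    using bij_betw_same_card[OF bij] by (simp add: card_hadamard_index tensor_index_def card_PiE)
  also have "\<dots> = m' ^ 2 * r * C"
    using k(1) m'(3) unfolding C_def by (subst prod.remove[of _ k]) auto
  finally have "m ^ 2 = m' ^ 2 * C" using assms(3) by simp
  then have mC: "2 ^ (2 * s) = m' ^ 2 * C" using assms(2)
    by (metis mult.commute power_mult)
  have card_dvd: "card (I l) dvd C" if "l \<in> {1..v}" "l \<noteq> k" for l
    unfolding C_def using that by (intro dvd_prodI) auto
  obtain l where "l \<in> {1..v}" "l \<noteq> k" using v by (metis atLeastAtMost_iff one_le_numeral order.trans order_refl numeral_One numeral_eq_iff semiring_norm(85))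
  then have "C \<noteq> 1" using card_dvd fac(1) by fastforce
  have C_dvd: "C dvd 2 ^ (2 * s)" using mC by simp
  then obtain i where C: "C = 2 ^ i" using divides_primepow_nat two_is_prime_nat by metis
  have evC: "even C" using \<open>C \<noteq> 1\<close> C by simp
  have m4: "4 dvd m' ^ 2" using m'(2) by (auto simp: power2_eq_square elim!: evenE)
  define M where "M = m ^ 2"
  have M: "M = m' ^ 2 * C" "M = 2 ^ (2 * s)"
    using mC \<open>m ^ 2 = m' ^ 2 * C\<close> by (simp_all add: M_def)
  \<comment> \<open>Divisibility by 8 suffices for 16, because M = 2^(2s) has an even
    exponent.\<close>
  have "4 * 2 dvd M" unfolding M(1) using m4 evC by (rule mult_dvd_mono)
  then have "2 ^ 3 dvd (2::nat) ^ (2 * s)" using M(2) by simp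
  then have "3 \<le> 2 * s" by (rule power_dvd_imp_le) simp
  then have "4 \<le> 2 * s" by presburger
  then have M16: "16 dvd M" using le_imp_power_dvd[of 4 "2 * s" "2::nat"] M(2) by simp
  have Mk: "2 * m' ^ 2 dvd M" unfolding M(1) using evC by (simp add: mult.commute mult_dvd_mono)
  have sgn_factor: "sgn (W l x y) ^ M = sgn (W l x x) ^ M"
    if l: "l \<in> {1..v}" and xy: "x \<in> I l" "y \<in> I l" for l x y
  proof (cases "l = k")
    case True
    then show ?thesis using sgn_k[OF M16 Mk] xy assms(3) by simp
  next
    case False
    \<comment> \<open>The factor 2 is absorbed by m'^2, and |I l| divides C.\<close>
    have d: "2 * card (I l) dvd M"
      unfolding M(1) using card_dvd[OF l False] m'(2) by (intro mult_dvd_mono) auto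
    have n3: "\<not> 3 dvd card (I l)"
    proof
      assume "3 dvd card (I l)"
      then have "3 dvd (2::nat) ^ i" using card_dvd[OF l False] C dvd_trans by blast
      then have "3 dvd (2::nat)" by (rule prime_dvd_power[rotated]) simp
      then show False by simp
    qed
    show ?thesis by (rule known_spin_model_sgn[OF fac(2)[OF l] M16 d n3 xy])
  qed
  have "sgn (tensor v W \<alpha> \<beta>) ^ M = sgn (tensor v W \<alpha> \<alpha>) ^ M" if "\<alpha> \<in> ?T" "\<beta> \<in> ?T" for \<alpha> \<beta>
  proof -
    have "\<alpha> l \<in> I l" "\<beta> l \<in> I l" if "l \<in> {1..v}" for l
      using \<open>\<alpha> \<in> ?T\<close> \<open>\<beta> \<in> ?T\<close> that by (auto simp: tensor_index_def)
    then show ?thesis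
      unfolding tensor_def sgn_prod prod_power_distrib by (intro prod.cong refl sgn_factor) auto
  qed
  then have eq_sgn: "sgn (W_mat m H u a (0,0,1) (1,0,1)) ^ M = sgn (W_mat m H u a (0,0,1) (0,0,1)) ^ M"
    using eq pts fT by metis
  have uM: "sgn u ^ M = 1"
    using power_eq_1_dvd[OF potts_param_sgn[OF u] M16] assms(3) by simp
  have evM: "even M" using m2 by (simp add: M_def)
  note sgn_V = sgn_V_block_power[OF assms(4) _ _ uM evM]
  have "sgn (W_mat m H u a (0,0,1) (0,0,1)) ^ M = 1"
    using sgn_V assms(3) by (simp add: W_mat_def)
  \<comment> \<open>Here i - j = -1 and both l-coordinates are 0, so the exponent of
    \<open>a\<close> is 1 - m, which is odd, while a^M = -1.\<close>
  moreover have "sgn (W_mat m H u a (0,0,1) (1,0,1)) ^ M = -1"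
  proof -
    have "(a ^ M) ^ 2 = 1" using a(1) by (simp add: M_def mult.commute flip: power_mult)
    then have aM: "a ^ M = -1" using a(2) by (auto simp: M_def power2_eq_1_iff)
    have sgn_powi: "sgn (a powi n) = a powi n" for n
      using norm_powi_root_of_unity[OF na] by (simp add: sgn_div_norm)
    have "(a powi (1 - int m)) ^ M = (a ^ M) powi (1 - int m)"
      by (metis mult.commute power_int_mult power_int_of_nat)
    also have "\<dots> = -1" using aM m2(2) by simp
    finally show ?thesis
      using sgn_V[of 1 1 0 1] assms(3)
      by (simp add: W_mat_def Real_Vector_Spaces.sgn_mult power_mult_distrib sgn_powi)
  qed
  ultimately show False using eq_sgn by simp
qed

end
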